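(* Assume that the size of any symbol in $\Pi$ is constant. For a dictionary $\mathcal{D}=\{P_1,\dots,P_d\}$ of total size $\sum_k|P_k|=m$, $\mathrm{SCERA}(\mathcal{D})$ (its states, goto, failure and output functions) can be implemented in $O(m)$ space.
   Context: Strings are 1-indexed; $X[i:j]$ is the substring from $i$ to $j$ ($=\varepsilon$ if $j<i$), $X[:j]=X[1:j]$. An equivalence relation $\approx\subseteq\Sigma^*\times\Sigma^*$ is a substring consistent equivalence relation (SCER) if $X\approx Y$ implies $|X|=|Y|$ and $X[i:j]\approx Y[i:j]$ for all $1\le i\le j\le|X|$. A prefix encoding w.r.t. $\approx$ is a map $f:\Sigma^*\to\Pi^*$ with $|f(X)|=|X|$, $f(X[:i])=f(X)[:i]$, and $f(X)=f(Y)$ iff $X\approx Y$. $\mathcal{D}$ is a set of nonempty strings over $\Sigma$; $\mathrm{Pref}(f(\mathcal{D}))$ is the set of all prefixes of $f(P_1),\dots,f(P_d)$. $\mathrm{SCERA}(\mathcal{D})$: states are the elements of $\mathrm{Pref}(f(\mathcal{D}))$. Goto: $\mathrm{goto}(S,c)=Sc$ if $Sc$ is a state, else $\mathrm{Null}$. Failure: $\mathrm{Fail}(\varepsilon)=\mathrm{Null}$ and for $1\le j\le|P_k|$, $\mathrm{Fail}(f(P_k)[:j])=f(P_k[i:j])$ where $i=\min\{l\mid l>1,\ f(P_k[l:j])\in\mathrm{Pref}(f(\mathcal{D}))\}$. Output: $\mathrm{Out}(f(P_k)[:j])=\{P\in\mathcal{D}\mid P\approx P_k[i:j]\text{ for some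 }1\le i\le j\}$. *)

theory Defs
  imports Main "HOL-Library.Sublist"
begin

section \<open>Substring consistent equivalence relations and prefix encodings\<close>

text \<open>Positions are 1-based; the value is the empty string if \<open>j < i\<close>.\<close>

definition substr :: "'a list \<Rightarrow> nat \<Rightarrow> nat \<Rightarrow> 'a list" where
  "substr X i j = take (Suc j - i) (drop (i - 1) X)"

definition SCER :: "('a list \<Rightarrow> 'a list \<Rightarrow> bool) \<Rightarrow> bool" where
  "SCER eqv \<longleftrightarrow> equivp eqv \<and>
     (\<forall>X Y. eqv X Y \<longrightarrow> length X = length Y \<and>
        (\<forall>i j. 1 \<le> i \<and> i \<le> j \<and> j \<le> length X \<longrightarrow> eqv (substr X i j) (substr Y i j)))"

definition prefix_encoding :: "('a list \<Rightarrow> 'a list \<Rightarrow> bool) \<Rightarrow> ('a list \<Rightarrow> 'p list) \<Rightarrow> bool" where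
  "prefix_encoding eqv f \<longleftrightarrow>
     (\<forall>X. length (f X) = length X) \<and>
     (\<forall>X. \<forall>i \<le> length X. f (take i X) = take i (f X)) \<and>
     (\<forall>X Y. f X = f Y \<longleftrightarrow> eqv X Y)"


section \<open>The automaton\<close>

definition scera_states :: "('a list \<Rightarrow> 'p list) \<Rightarrow> 'a list set \<Rightarrow> 'p list set" where
  "scera_states f D = {S. \<exists>P\<in>D. prefix S (f P)}"

text \<open>The value \<open>None\<close> stands for \<open>Null\<close>.\<close>

definition scera_goto ::
  "('a list \<Rightarrow> 'p list) \<Rightarrow> 'a list set \<Rightarrow> 'p list \<Rightarrow> 'p \<Rightarrow> 'p list option" where
  "scera_goto f D S c = (if S @ [c] \<in> scera_states f D then Some (S @ [c]) else None)"

definition fail_pos :: "('a list \<Rightarrow> 'p list) \<Rightarrow> 'a list set \<Rightarrow> 'a list \<Rightarrow> nat \<Rightarrow> nat" where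
  "fail_pos f D P j = (LEAST l. l > 1 \<and> f (substr P l j) \<in> scera_states f D)"

text \<open>
  A state can be written as \<open>take j (f P)\<close> for several \<open>P \<in> D\<close>. The lemmas \<open>scera_fail_eq\<close>
  and \<open>scera_out_eq\<close> below show that the value does not depend on this choice.
\<close>

definition scera_fail ::
  "('a list \<Rightarrow> 'p list) \<Rightarrow> 'a list set \<Rightarrow> 'p list \<Rightarrow> 'p list option" where
  "scera_fail f D S =
     (if S = [] then None
      else Some (THE T. \<exists>P\<in>D. \<exists>j. 1 \<le> j \<and> j \<le> length P \<and> S = take j (f P) \<and>
                   T = f (substr P (fail_pos f D P j) j)))"

definition scera_out ::
  "('a list \<Rightarrow> 'a list \<Rightarrow> bool) \<Rightarrow> ('a list \<Rightarrow> 'p list) \<Rightarrow> 'a list set \<Rightarrow> 'p list \<Rightarrow> 'a list set" where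
  "scera_out eqv f D S =
     {Q \<in> D. \<exists>P\<in>D. \<exists>j \<le> length P. S = take j (f P) \<and>
                (\<exists>i. 1 \<le> i \<and> i \<le> j \<and> eqv Q (substr P i j))}"

lemma substr_take: "i \<ge> 1 \<Longrightarrow> substr (take j X) i j = substr X i j"
  by (simp add: substr_def drop_take min_def)

lemma substr_cong:
  assumes "SCER eqv" "prefix_encoding eqv f" "j \<le> length P" "j' \<le> length Q"
    and eq: "take j' (f Q) = take j (f P)" and i: "i \<ge> 1"
  shows "j' = j" "eqv (substr Q i j) (substr P i j)"
proof -
  have len: "length (f X) = length X" for X
    using assms(2) by (simp add: prefix_encoding_def)
  show j: "j' = j"
    using arg_cong[OF eq, of length] assms(3,4) len by simp
  have "f (take j Q) = f (take j P)"
    using assms(2-4) eq j by (simp add: prefix_encoding_def)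
  then have e: "eqv (take j Q) (take j P)"
    using assms(2) by (simp add: prefix_encoding_def)
  show "eqv (substr Q i j) (substr P i j)"
  proof (cases "i \<le> j")
    case True
    then have "eqv (substr (take j Q) i j) (substr (take j P) i j)"
      using assms(1,3,4) e i j by (simp add: SCER_def)
    then show ?thesis using i by (simp add: substr_take)
  next
    case False
    then have "substr Q i j = []" "substr P i j = []" by (simp_all add: substr_def)
    then show ?thesis using assms(1) by (simp add: SCER_def equivp_reflp)
  qed
qed

lemma scera_fail_eq:
  assumes "SCER eqv" "prefix_encoding eqv f" "P \<in> D" "1 \<le> j" "j \<le> length P"
  shows "scera_fail f D (take j (f P)) = Some (f (substr P (fail_pos f D P j) j))"
proof -
  have len: "length (f X) = length X" for X
    using assms(2) by (simp add: prefix_encoding_def)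
  have ne: "take j (f P) \<noteq> []"
    using len[of P] assms(4,5) by auto
  have ind: "f (substr Q (fail_pos f D Q j') j') = f (substr P (fail_pos f D P j) j)"
    if Q: "j' \<le> length Q" "take j (f P) = take j' (f Q)" for Q j'
  proof -
    have j: "j' = j" using substr_cong(1)[OF assms(1,2,5) Q(1) Q(2)[symmetric] order_refl] .
    have s: "f (substr Q i j) = f (substr P i j)" if "i \<ge> 1" for i
      using substr_cong(2)[OF assms(1,2,5) Q(1) Q(2)[symmetric] that] assms(2)
      by (simp add: prefix_encoding_def)
    have "fail_pos f D Q j = fail_pos f D P j"
      unfolding fail_pos_def by (rule arg_cong[of _ _ Least]) (auto simp: s)
    moreover have "fail_pos f D P j \<ge> 1"
    proof -
      have z: "f (substr P (Suc j) j) = []" using len[of "[]"] by (simp add: substr_def)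
      have "1 < fail_pos f D P j \<and> f (substr P (fail_pos f D P j) j) \<in> scera_states f D"
        unfolding fail_pos_def
        by (rule LeastI[of _ "Suc j"]) (use assms(3,4) z in \<open>auto simp: scera_states_def\<close>)
      then show ?thesis by simp
    qed
    ultimately show ?thesis using j s by simp
  qed
  have "(THE T. \<exists>Q\<in>D. \<exists>j'. 1 \<le> j' \<and> j' \<le> length Q \<and> take j (f P) = take j' (f Q) \<and>
          T = f (substr Q (fail_pos f D Q j') j')) = f (substr P (fail_pos f D P j) j)"
    by (rule the_equality) (use assms(3-5) ind in \<open>blast+\<close>)
  then show ?thesis using ne by (simp add: scera_fail_def)
qed

lemma scera_out_eq:
  assumes "SCER eqv" "prefix_encoding eqv f" "P \<in> D" "j \<le> length P"
  shows "scera_out eqv f D (take j (f P)) =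
           {Q \<in> D. \<exists>i. 1 \<le> i \<and> i \<le> j \<and> eqv Q (substr P i j)}"
proof -
  have "eqv Q (substr P i j)"
    if "j' \<le> length P'" "take j (f P) = take j' (f P')" "1 \<le> i" "eqv Q (substr P' i j')"
    for Q P' i j'
    using substr_cong[OF assms(1,2,4) that(1) that(2)[symmetric] that(3)] that(4) assms(1)
    unfolding SCER_def by (metis equivp_transp)
  moreover have "j' = j"
    if "j' \<le> length P'" "take j (f P) = take j' (f P')" for P' j'
    using substr_cong(1)[OF assms(1,2,4) that(1) that(2)[symmetric] order_refl] .
  ultimately show ?thesis
    unfolding scera_out_def using assms(3,4) by blast
qed


section \<open>Implementations and their space\<close>

text \<open>
  Space is measured on a pointer machine. The data structure stored for a dictionary is a
  finite sequence of cells; each cell holds a null value, a pointer to a cell, a symbol of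
  the encoding alphabet, or the number of a pattern. Queries are answered by fixed programs
  that have finitely many registers, follow pointers at constant offsets, and compare cells
  for equality. There is no arithmetic on addresses and symbols are atomic, so a cell cannot
  hide more information than it is charged for. Every such program runs unchanged on a word
  RAM.
\<close>

datatype 'p cell = Null | Ptr nat | Sym 'p | Pat nat

type_synonym 'p heap = "'p cell list"
type_synonym 'p regs = "nat \<Rightarrow> 'p cell"

datatype test = Is_null nat | Is_equal nat nat | Neg test

datatype com =
    Skip
  | Clear nat
  | Move nat nat
  | Load nat nat nat  \<comment> \<open>\<open>Load x y i\<close>: register \<open>x\<close> receives the cell \<open>i\<close> places after the one \<open>y\<close> points to\<close>
  | Emit nat
  | Seq com com
  | Cond test com com
  | Loop test com

fun holds :: "test \<Rightarrow> 'p regs \<Rightarrow> bool" where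
  "holds (Is_null x) s \<longleftrightarrow> s x = Null"
| "holds (Is_equal x y) s \<longleftrightarrow> s x = s y"
| "holds (Neg b) s \<longleftrightarrow> \<not> holds b s"

text \<open>
  \<open>exec h c s w s'\<close>: on heap \<open>h\<close> and registers \<open>s\<close>, the program \<open>c\<close> terminates with registers
  \<open>s'\<close> and has emitted the sequence \<open>w\<close>. Loading through a non-pointer or from outside the
  heap has no transition.
\<close>

inductive exec :: "'p heap \<Rightarrow> com \<Rightarrow> 'p regs \<Rightarrow> 'p cell list \<Rightarrow> 'p regs \<Rightarrow> bool"
  for h :: "'p heap" where
  Skip: "exec h Skip s [] s"
| Clear: "exec h (Clear x) s [] (s(x := Null))"
| Move: "exec h (Move x y) s [] (s(x := s y))"
| Load: "s y = Ptr a \<Longrightarrow> a + i < length h \<Longrightarrow> exec h (Load x y i) s [] (s(x := h ! (a + i)))"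
| Emit: "exec h (Emit x) s [s x] s"
| Seq: "exec h c1 s w1 s1 \<Longrightarrow> exec h c2 s1 w2 s2 \<Longrightarrow> exec h (Seq c1 c2) s (w1 @ w2) s2"
| CondT: "holds b s \<Longrightarrow> exec h c1 s w s1 \<Longrightarrow> exec h (Cond b c1 c2) s w s1"
| CondF: "\<not> holds b s \<Longrightarrow> exec h c2 s w s1 \<Longrightarrow> exec h (Cond b c1 c2) s w s1"
| LoopF: "\<not> holds b s \<Longrightarrow> exec h (Loop b c) s [] s"
| LoopT: "holds b s \<Longrightarrow> exec h c s w1 s1 \<Longrightarrow> exec h (Loop b c) s1 w2 s2 \<Longrightarrow>
    exec h (Loop b c) s (w1 @ w2) s2"

inductive_cases exec_elims:
  "exec h Skip s w s'" "exec h (Clear x) s w s'" "exec h (Move x y) s w s'"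
  "exec h (Load x y i) s w s'" "exec h (Emit x) s w s'" "exec h (Seq c1 c2) s w s'"
  "exec h (Cond b c1 c2) s w s'" "exec h (Loop b c) s w s'"

lemma exec_deterministic:
  "exec h c s w s' \<Longrightarrow> exec h c s v t \<Longrightarrow> v = w \<and> t = s'"
proof (induction arbitrary: v t rule: exec.induct)
  case (LoopT b s c w1 s1 w2 s2)
  from LoopT.prems LoopT.hyps(1) obtain v1 t1 v2
    where "exec h c s v1 t1" "exec h (Loop b c) t1 v2 t" "v = v1 @ v2"
    by (auto elim: exec_elims)
  then show ?case using LoopT.IH by blast
qed (erule exec_elims; fastforce)+

text \<open>
  No dangling pointers, and pattern numbers range below the number \<open>d\<close> of patterns; hence
  pointers and pattern numbers fit into one machine word each.
\<close>

definition wf_heap :: "nat \<Rightarrow> 'p heap \<Rightarrow> bool" where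
  "wf_heap d h \<longleftrightarrow> (\<forall>a. Ptr a \<in> set h \<longrightarrow> a < length h) \<and> (\<forall>k. Pat k \<in> set h \<longrightarrow> k < d)"

text \<open>Space is counted in machine words; \<open>sz\<close> gives the size of a symbol.\<close>

fun cell_space :: "('p \<Rightarrow> nat) \<Rightarrow> 'p cell \<Rightarrow> nat" where
  "cell_space sz (Sym x) = max 1 (sz x)"
| "cell_space sz _ = 1"

definition heap_space :: "('p \<Rightarrow> nat) \<Rightarrow> 'p heap \<Rightarrow> nat" where
  "heap_space sz h = (\<Sum>v\<leftarrow>h. cell_space sz v)"

fun state_cell :: "('p list \<Rightarrow> nat) \<Rightarrow> 'p list option \<Rightarrow> 'p cell" where
  "state_cell addr None = Null"
| "state_cell addr (Some S) = Ptr (addr S)"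

definition init_regs :: "'p cell list \<Rightarrow> 'p regs" where
  "init_regs args = (\<lambda>x. if x < length args then args ! x else Null)"

text \<open>
  The dictionary is the set of the strings in \<open>Ps\<close>. Each state is represented by the address
  of a cell, the initial state by address 0. Arguments are passed in registers 0 and 1;
  the goto and failure programs return their result in register 0, and the output program
  emits the numbers of the patterns in the output set, each of them once.
\<close>

definition implements_scera ::
  "('a list \<Rightarrow> 'a list \<Rightarrow> bool) \<Rightarrow> ('a list \<Rightarrow> 'p list) \<Rightarrow> 'a list list \<Rightarrow>
   com \<Rightarrow> com \<Rightarrow> com \<Rightarrow> 'p heap \<Rightarrow> bool" where
  "implements_scera eqv f Ps goto_prog fail_prog out_prog h \<longleftrightarrow>
     wf_heap (length Ps) h \<and>
     (\<exists>addr. inj_on addr (scera_states f (set Ps)) \<and>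
        addr [] = 0 \<and>
        (\<forall>S \<in> scera_states f (set Ps). addr S < length h) \<and>
        (\<forall>S \<in> scera_states f (set Ps). \<forall>c. \<exists>s.
           exec h goto_prog (init_regs [Ptr (addr S), Sym c]) [] s \<and>
           s 0 = state_cell addr (scera_goto f (set Ps) S c)) \<and>
        (\<forall>S \<in> scera_states f (set Ps). \<exists>s.
           exec h fail_prog (init_regs [Ptr (addr S)]) [] s \<and>
           s 0 = state_cell addr (scera_fail f (set Ps) S)) \<and>
        (\<forall>S \<in> scera_states f (set Ps). \<exists>ks s.
           exec h out_prog (init_regs [Ptr (addr S)]) (map Pat ks) s \<and>
           distinct ks \<and>
           set ks = {k. k < length Ps \<and> Ps ! k \<in> scera_out eqv f (set Ps) S}))"

end

theory Submission
  imports Defs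
begin

text \<open>
  The trie of the encoded patterns has at most \<open>m + 1\<close> nodes. It is stored in
  first-child/next-sibling form, each node carrying in addition its failure link and the head of
  the list of patterns whose encoding is that node; the pattern lists are disjoint, so they have
  \<open>d \<le> m\<close> elements altogether. The output sets themselves may be of quadratic total size and are
  not stored: the chain of failure links from \<open>f X\<close> visits exactly the states of the form
  \<open>f Y\<close> with \<open>Y\<close> a suffix of \<open>X\<close>, so the output set is the union of the pattern lists along it.
\<close>

section \<open>Lists and linked lists\<close>

text \<open>Records of one kind have a constant number \<open>c\<close> of cells, so a field is
  reached at a constant offset from the start of its record.\<close>

lemma nth_concat_blocks:
  assumes "\<And>x. x \<in> set xs \<Longrightarrow> length (g x) = c" "i < length xs" "r < c"
  shows "concat (map g xs) ! (c * i + r) = g (xs ! i) ! r"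
  using assms
proof (induction xs arbitrary: i)
  case (Cons x xs)
  then show ?case by (cases i) (auto simp: nth_append)
qed simp

lemma length_concat_blocks:
  assumes "\<And>x. x \<in> set xs \<Longrightarrow> length (g x) = c"
  shows "length (concat (map g xs)) = c * length xs"
  using assms by (induction xs) auto

definition position :: "'b list \<Rightarrow> 'b \<Rightarrow> nat" where
  "position xs x = length (takeWhile (\<lambda>y. y \<noteq> x) xs)"

lemma position_less: "x \<in> set xs \<Longrightarrow> position xs x < length xs"
  unfolding position_def by (induction xs) auto

lemma nth_position: "x \<in> set xs \<Longrightarrow> xs ! position xs x = x"
  unfolding position_def by (induction xs) auto

text \<open>If \<open>x\<close> occurs only once, the rest of the list is a function of
  \<open>x\<close> alone. This lets the record of \<open>x\<close> carry its own next
  pointer.\<close>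

definition after :: "'b list \<Rightarrow> 'b \<Rightarrow> 'b list" where
  "after xs x = tl (dropWhile (\<lambda>y. y \<noteq> x) xs)"

lemma after_append: "distinct (ys @ x # zs) \<Longrightarrow> after (ys @ x # zs) x = zs"
  unfolding after_def by (subst dropWhile_append2) auto

lemma set_after: "set (after xs x) \<subseteq> set xs"
  unfolding after_def by (induction xs) (auto dest: list.set_sel(2))

text \<open>A linked list is denoted by a pointer to its head; the tail is found through the record
  stored at that address.\<close>

fun link :: "('b \<Rightarrow> nat) \<Rightarrow> 'b list \<Rightarrow> 'p cell" where
  "link addr [] = Null"
| "link addr (x # xs) = Ptr (addr x)"

lemma link_PtrD: "link addr xs = Ptr a \<Longrightarrow> \<exists>x\<in>set xs. a = addr x"
  by (cases xs) auto

lemma link_neq_Pat [simp]: "link addr xs \<noteq> Pat k" "Pat k \<noteq> link addr xs"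
  by (cases xs; simp)+

lemma state_cell_PtrD: "state_cell addr T = Ptr a \<Longrightarrow> \<exists>S. T = Some S \<and> a = addr S"
  by (cases T) auto

lemma state_cell_neq_Pat [simp]: "state_cell addr T \<noteq> Pat k" "Pat k \<noteq> state_cell addr T"
  by (cases T; simp)+

text \<open>The factor is \<open>max 1 K\<close> because null values, pointers and pattern numbers
  cost one word even when \<open>K = 0\<close>.\<close>

lemma heap_space_le:
  assumes "\<forall>x. sz x \<le> K"
  shows "heap_space sz h \<le> max 1 K * length h"
proof -
  have "cell_space sz v \<le> max 1 K" for v
    using assms by (cases v) (auto simp: max_def intro: order_trans le_SucI)
  then show ?thesis
    unfolding heap_space_def by (induction h) (auto intro: add_mono)
qed

section \<open>The programs\<close>

text \<open>
  Tests have no conjunction: at the end of the list of children, register 2 receives the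
  symbol that is searched for, which stops the loop.
\<close>

definition goto_step :: com where
  "goto_step = Cond (Is_null 0) (Move 2 1) (Load 2 0 2)"

definition goto_loop :: com where
  "goto_loop = Loop (Neg (Is_equal 2 1)) (Seq (Load 0 0 1) goto_step)"

definition goto_program :: com where
  "goto_program = Seq (Load 0 0 0) (Seq goto_step goto_loop)"

definition fail_program :: com where
  "fail_program = Load 0 0 3"

text \<open>Register 0 is left alone: it still holds the current state when the enclosing loop goes
  on to follow the failure link.\<close>

definition pattern_loop :: com where
  "pattern_loop = Loop (Neg (Is_null 1)) (Seq (Load 2 1 0) (Seq (Emit 2) (Load 1 1 1)))"

definition out_program :: com where
  "out_program = Loop (Neg (Is_null 0)) (Seq (Load 1 0 4) (Seq pattern_loop (Load 0 0 3)))"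

section \<open>Failure links and output sets\<close>

lemma substr_eq_drop: "1 \<le> i \<Longrightarrow> substr X i j = drop (i - 1) (take j X)"
  by (simp add: substr_def drop_take)

text \<open>With an empty dictionary there is no state at all, not even the root; that case is
  handled by \<open>implements_scera_empty\<close>.\<close>

locale scera_dictionary =
  fixes eqv :: "'a list \<Rightarrow> 'a list \<Rightarrow> bool"
    and f :: "'a list \<Rightarrow> 'p list"
    and Ps :: "'a list list"
  assumes scer: "SCER eqv"
    and enc: "prefix_encoding eqv f"
    and dict_nonempty: "Ps \<noteq> []"
    and patterns_nonempty: "[] \<notin> set Ps"
begin

abbreviation "states \<equiv> scera_states f (set Ps)"
abbreviation "fail \<equiv> scera_fail f (set Ps)"
abbreviation "out \<equiv> scera_out eqv f (set Ps)"

lemma length_f [simp]: "length (f X) = length X"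
  and f_take: "i \<le> length X \<Longrightarrow> f (take i X) = take i (f X)"
  and f_eq_iff: "f X = f Y \<longleftrightarrow> eqv X Y"
  using enc by (simp_all add: prefix_encoding_def)

lemma f_Nil [simp]: "f [] = []"
  using length_f[of "[]"] by (simp del: length_f)

lemma f_eq_Nil_iff [simp]: "f X = [] \<longleftrightarrow> X = []"
  using length_f[of X] by (metis length_0_conv)

lemma Nil_in_states [simp]: "[] \<in> states"
  using dict_nonempty by (cases Ps) (auto simp: scera_states_def)

lemma f_in_states: "P \<in> set Ps \<Longrightarrow> f P \<in> states"
  by (auto simp: scera_states_def)

text \<open>Presents a state as the encoding of a string. Suffixes have to be taken in the string,
  since a suffix of a code need not be the code of a suffix.\<close>

lemma statesE:
  assumes "S \<in> states"
  obtains P j where "P \<in> set Ps" "j \<le> length P" "S = f (take j P)" "j = length S"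
proof -
  obtain P where P: "P \<in> set Ps" "prefix S (f P)"
    using assms by (auto simp: scera_states_def)
  have le: "length S \<le> length P"
    using prefix_length_le[OF P(2)] by simp
  have "S = take (length S) (f P)"
    using P(2) by (auto simp: prefix_def)
  then show ?thesis
    using that[OF P(1) le] f_take[OF le] by simp
qed

text \<open>This is where substring consistency enters: the code of a suffix depends only on the
  code of the whole string, so any representative of a state serves.\<close>

lemma f_drop_cong:
  assumes "f X = f Y"
  shows "f (drop i X) = f (drop i Y)"
proof -
  have len: "length X = length Y"
    using arg_cong[OF assms, of length] by simp
  show ?thesis
  proof (cases "i < length X")
    case True
    have "eqv (substr X (Suc i) (length X)) (substr Y (Suc i) (length X))"
      using scer assms True unfolding SCER_def f_eq_iff by simp
    then show ?thesis
      using len by (simp add: substr_eq_drop f_eq_iff)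
  qed (use len in simp)
qed

text \<open>Frees the output set from the chosen pattern and from 1-based positions. The strict
  bound on \<open>i\<close> leaves out the empty suffix.\<close>

lemma out_f:
  assumes "f X \<in> states"
  shows "out (f X) = {Q \<in> set Ps. \<exists>i < length X. f Q = f (drop i X)}"
proof -
  obtain P j where P: "P \<in> set Ps" "j \<le> length P" "f X = f (take j P)" "j = length X"
    using statesE[OF assms] length_f by metis
  have "out (f X) = {Q \<in> set Ps. \<exists>i. 1 \<le> i \<and> i \<le> j \<and> eqv Q (substr P i j)}"
    using scera_out_eq[OF scer enc P(1,2)] P(2,3) by (simp add: f_take)
  also have "\<dots> = {Q \<in> set Ps. \<exists>i. 1 \<le> i \<and> i \<le> j \<and> f Q = f (drop (i - 1) X)}"
    by (auto simp: substr_eq_drop f_eq_iff[symmetric] f_drop_cong[OF P(3)])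
  also have "\<dots> = {Q \<in> set Ps. \<exists>i < length X. f Q = f (drop i X)}"
  proof -
    have "(\<exists>i. 1 \<le> i \<and> i \<le> j \<and> f Q = f (drop (i - 1) X)) \<longleftrightarrow> (\<exists>i < length X. f Q = f (drop i X))" for Q
    proof
      assume "\<exists>i. 1 \<le> i \<and> i \<le> j \<and> f Q = f (drop (i - 1) X)"
      then obtain i where "1 \<le> i" "i \<le> j" "f Q = f (drop (i - 1) X)" by blast
      then show "\<exists>i < length X. f Q = f (drop i X)" using P(4) by (intro exI[of _ "i - 1"]) auto
    next
      assume "\<exists>i < length X. f Q = f (drop i X)"
      then obtain i where "i < length X" "f Q = f (drop i X)" by blast
      then show "\<exists>i. 1 \<le> i \<and> i \<le> j \<and> f Q = f (drop (i - 1) X)" using P(4) by (intro exI[of _ "Suc i"]) auto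
    qed
    then show ?thesis by (simp only:)
  qed
  finally show ?thesis .
qed

text \<open>The least admissible position gives the longest proper suffix of \<open>X\<close> whose
  code is a state. The last conclusion records this maximality for \<open>out_rec\<close>.\<close>

lemma fail_f:
  assumes "f X \<in> states" "X \<noteq> []"
  obtains l where "1 \<le> l" "l \<le> length X" "fail (f X) = Some (f (drop l X))"
    "f (drop l X) \<in> states" "\<And>i. 1 \<le> i \<Longrightarrow> i < l \<Longrightarrow> f (drop i X) \<notin> states"
proof -
  obtain P j where P: "P \<in> set Ps" "j \<le> length P" "f X = f (take j P)" "j = length X"
    using statesE[OF assms(1)] length_f by metis
  let ?ok = "\<lambda>l. l > 1 \<and> f (substr P l j) \<in> states"
  define l where "l = fail_pos f (set Ps) P j"
  have sub: "f (substr P (Suc i) j) = f (drop i X)" for i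
    using f_drop_cong[OF P(3), of i] by (simp add: substr_eq_drop)
  \<comment> \<open>Position \<open>Suc j\<close> yields the empty suffix, whose code is the root;
    hence the minimum exists and \<open>l\<close> is at most \<open>Suc j\<close>.\<close>
  have ok: "?ok (Suc j)"
    using assms(2) P(4) sub[of j] by simp
  have l: "?ok l"
    unfolding l_def fail_pos_def by (rule LeastI[of ?ok, OF ok])
  have l_le: "l \<le> Suc j"
    unfolding l_def fail_pos_def by (rule Least_le[of ?ok, OF ok])
  have least: "\<not> ?ok i" if "i < l" for i
    using not_less_Least[of i ?ok] that unfolding l_def fail_pos_def by simp
  have suc: "Suc (l - 1) = l" using l by simp
  have "fail (f X) = Some (f (substr P l j))"
    using scera_fail_eq[OF scer enc P(1) _ P(2)] assms(2) P(2-4)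
    by (simp add: l_def f_take Suc_le_eq)
  moreover have "f (drop i X) \<notin> states" if "1 \<le> i" "i < l - 1" for i
    using least[of "Suc i"] sub[of i] that by auto
  ultimately show ?thesis
    using that[of "l - 1"] l l_le P(4) sub[of "l - 1"] suc by auto
qed

lemma fail_Nil: "fail [] = None"
  by (simp add: scera_fail_def)

text \<open>Failure links shorten the state, so chains of them end; this is the measure for the
  output program.\<close>

lemma fail_SomeD:
  assumes "S \<in> states" "fail S = Some T"
  shows "T \<in> states" "length T < length S"
proof -
  obtain X where X: "S = f X" using assms(1) by (blast elim: statesE)
  have "X \<noteq> []" using assms(2) X by (auto simp: fail_Nil)
  then obtain l where "1 \<le> l" "l \<le> length X" "fail (f X) = Some (f (drop l X))"
    "f (drop l X) \<in> states"
    using assms(1) X by (metis fail_f)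
  then show "T \<in> states" "length T < length S"
    using assms(2) X \<open>X \<noteq> []\<close> by auto
qed

lemma fail_eq_NoneD:
  assumes "S \<in> states" "fail S = None"
  shows "S = []"
proof (rule ccontr)
  assume "S \<noteq> []"
  moreover obtain X where X: "S = f X" using assms(1) by (blast elim: statesE)
  ultimately have "X \<noteq> []" by simp
  with assms(1) X obtain l where "fail (f X) = Some (f (drop l X))"
    by (metis fail_f)
  then show False using assms(2) X by simp
qed

lemma out_Nil: "out [] = {}"
  by (auto simp: scera_out_def)

text \<open>A pattern's code is a state, so it cannot be the code of a proper suffix longer than the
  one chosen by the failure link. What remains is \<open>X\<close> itself and the nonempty suffixes
  of \<open>drop l X\<close>.\<close>

lemma out_rec:
  assumes "S \<in> states" "fail S = Some T"
  shows "out S = {Q \<in> set Ps. f Q = S} \<union> out T"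
proof -
  obtain X where X: "S = f X" using assms(1) by (blast elim: statesE)
  have "X \<noteq> []" using assms(2) X by (auto simp: fail_Nil)
  then obtain l where l: "1 \<le> l" "l \<le> length X" "fail (f X) = Some (f (drop l X))"
    "f (drop l X) \<in> states" "\<And>i. 1 \<le> i \<Longrightarrow> i < l \<Longrightarrow> f (drop i X) \<notin> states"
    using fail_f[OF assms(1)[unfolded X]] by blast
  have T: "T = f (drop l X)" using l(3) assms(2) X by simp
  have "(\<exists>i < length X. f Q = f (drop i X)) \<longleftrightarrow>
      f Q = f X \<or> (\<exists>i < length X - l. f Q = f (drop i (drop l X)))" (is "?L \<longleftrightarrow> ?R")
    if "Q \<in> set Ps" for Q
  proof
    assume ?L
    then obtain i where i: "i < length X" "f Q = f (drop i X)" by blast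
    consider "i = 0" | "1 \<le> i" "i < l" | "l \<le> i" by linarith
    then show ?R
    proof cases
      case 2
      then show ?thesis using l(5) i f_in_states[OF that] by metis
    next
      case 3
      then have "i - l < length X - l" "f Q = f (drop (i - l) (drop l X))"
        using i by auto
      then show ?thesis by blast
    qed (use i in simp)
  next
    assume ?R
    then show ?L
    proof
      assume "f Q = f X"
      then show ?L using \<open>X \<noteq> []\<close> by (intro exI[of _ 0]) simp
    next
      assume "\<exists>i < length X - l. f Q = f (drop i (drop l X))"
      then obtain i where "i < length X - l" "f Q = f (drop i (drop l X))" by blast
      then show ?L by (intro exI[of _ "i + l"]) (simp add: add.commute)
    qed
  qed
  then show ?thesis
    unfolding T X out_f[OF assms(1)[unfolded X]] out_f[OF l(4)] by auto
qed

section \<open>The data structure\<close>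

text \<open>The root is put first so that it gets address 0; \<open>tl\<close> drops the empty
  prefix of each pattern, so the root is not listed again.\<close>

definition nodes :: "'p list list" where
  "nodes = [] # remdups (concat (map (\<lambda>P. tl (prefixes (f P))) Ps))"

definition children :: "'p list \<Rightarrow> 'p list list" where
  "children S = filter (\<lambda>T. T \<noteq> [] \<and> butlast T = S) nodes"

definition matches :: "'p list \<Rightarrow> nat list" where
  "matches S = filter (\<lambda>k. f (Ps ! k) = S) [0..<length Ps]"

definition addr :: "'p list \<Rightarrow> nat" where
  "addr S = 5 * position nodes S"

definition pattern_addr :: "nat \<Rightarrow> nat" where
  "pattern_addr k = 5 * length nodes + 2 * k"

text \<open>The symbol of an edge is stored at its lower end, which keeps the record constant in
  size whatever the degree. The root is nobody's child, so its sibling link is \<open>Null\<close>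
  because \<open>tl [] = []\<close>.\<close>

definition node_record :: "'p list \<Rightarrow> 'p cell list" where
  "node_record S =
     [link addr (children S),
      link addr (after (children (butlast S)) S),
      if S = [] then Null else Sym (last S),
      state_cell addr (fail S),
      link pattern_addr (matches S)]"

text \<open>Pattern \<open>k\<close> lies in one list only, that of the node
  \<open>f (Ps ! k)\<close>, so a single next pointer suffices.\<close>

definition pattern_record :: "nat \<Rightarrow> 'p cell list" where
  "pattern_record k = [Pat k, link pattern_addr (after (matches (f (Ps ! k))) k)]"

definition heap :: "'p heap" where
  "heap = concat (map node_record nodes) @ concat (map pattern_record [0..<length Ps])"

section \<open>Nodes, children and pattern lists of the trie\<close>

lemma set_tl_prefixes: "set (tl (prefixes xs)) = {ys. prefix ys xs \<and> ys \<noteq> []}"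
  by (cases xs) (auto simp: prefix_Cons)

lemma set_nodes: "set nodes = states"
proof -
  have "set nodes = insert [] {S. \<exists>P\<in>set Ps. prefix S (f P) \<and> S \<noteq> []}"
    by (auto simp: nodes_def set_tl_prefixes)
  also have "\<dots> = states"
    using Nil_in_states by (auto simp: scera_states_def)
  finally show ?thesis .
qed

lemma distinct_nodes: "distinct nodes"
  by (auto simp: nodes_def set_tl_prefixes)

lemma length_nodes: "length nodes \<le> Suc (\<Sum>P\<leftarrow>Ps. length P)"
proof -
  \<comment> \<open>Each pattern contributes as many nonempty prefixes as it has symbols; removing
    duplicates only lowers the count, and the root adds one.\<close>
  have "length (concat (map (\<lambda>P. tl (prefixes (f P))) Ps)) = (\<Sum>P\<leftarrow>Ps. length P)"
    by (simp add: length_concat comp_def)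
  then show ?thesis
    unfolding nodes_def using length_remdups_leq by (metis Suc_le_mono length_Cons)
qed

lemma distinct_children: "distinct (children S)"
  by (simp add: children_def distinct_nodes)

lemma set_children: "set (children S) = {T \<in> states. T \<noteq> [] \<and> butlast T = S}"
  by (auto simp: children_def set_nodes)

lemma distinct_matches: "distinct (matches S)"
  by (simp add: matches_def)

lemma set_matches: "set (matches S) = {k. k < length Ps \<and> f (Ps ! k) = S}"
  by (auto simp: matches_def)

section \<open>Layout of the heap and addresses\<close>

lemma length_node_records: "length (concat (map node_record nodes)) = 5 * length nodes"
  by (rule length_concat_blocks) (simp add: node_record_def)

lemma length_heap: "length heap = 5 * length nodes + 2 * length Ps"
proof -
  have "length (concat (map pattern_record [0..<length Ps])) = 2 * length [0..<length Ps]"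
    by (rule length_concat_blocks) (simp add: pattern_record_def)
  then show ?thesis by (simp add: heap_def length_node_records)
qed

lemma addr_less:
  assumes "S \<in> states" "r < 5"
  shows "addr S + r < length heap"
  using position_less[of S nodes] assms by (simp add: addr_def length_heap set_nodes)

lemma heap_node:
  assumes "S \<in> states" "r < 5"
  shows "heap ! (addr S + r) = node_record S ! r"
proof -
  have pos: "position nodes S < length nodes" "nodes ! position nodes S = S"
    using assms(1) by (simp_all add: position_less nth_position set_nodes)
  have "heap ! (addr S + r) = concat (map node_record nodes) ! (5 * position nodes S + r)"
    using pos(1) assms(2) by (simp add: heap_def nth_append length_node_records addr_def)
  also have "\<dots> = node_record (nodes ! position nodes S) ! r"
    by (rule nth_concat_blocks) (use pos assms(2) in \<open>simp_all add: node_record_def\<close>)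
  finally show ?thesis using pos(2) by simp
qed

lemma pattern_addr_less: "k < length Ps \<Longrightarrow> r < 2 \<Longrightarrow> pattern_addr k + r < length heap"
  by (simp add: pattern_addr_def length_heap)

lemma heap_pattern:
  assumes "k < length Ps" "r < 2"
  shows "heap ! (pattern_addr k + r) = pattern_record k ! r"
proof -
  have "heap ! (pattern_addr k + r) = concat (map pattern_record [0..<length Ps]) ! (2 * k + r)"
    by (simp add: heap_def nth_append length_node_records pattern_addr_def)
  also have "\<dots> = pattern_record ([0..<length Ps] ! k) ! r"
    by (rule nth_concat_blocks) (use assms in \<open>simp_all add: pattern_record_def\<close>)
  finally show ?thesis using assms(1) by simp
qed

lemma inj_on_addr: "inj_on addr states"
proof (rule inj_onI)
  fix S T
  assume ST: "S \<in> states" "T \<in> states" "addr S = addr T"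
  then have "position nodes S = position nodes T" by (simp add: addr_def)
  then show "S = T"
    using nth_position[of S nodes] nth_position[of T nodes] ST by (metis set_nodes)
qed

lemma addr_Nil: "addr [] = 0"
  by (simp add: addr_def position_def nodes_def)

lemma link_addr_less:
  assumes "link addr Ss = Ptr a" "set Ss \<subseteq> states"
  shows "a < length heap"
  using link_PtrD[OF assms(1)] assms(2) addr_less[of _ 0] by auto

lemma link_pattern_addr_less:
  assumes "link pattern_addr ks = Ptr a" "set ks \<subseteq> {..<length Ps}"
  shows "a < length heap"
  using link_PtrD[OF assms(1)] assms(2) pattern_addr_less[of _ 0] by auto

section \<open>Well-formedness and size of the heap\<close>

lemma wf_heap_heap: "wf_heap (length Ps) heap"
proof -
  have child: "set (children S) \<subseteq> states" for S
    by (auto simp: set_children)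
  have match: "set (matches S) \<subseteq> {..<length Ps}" for S
    by (auto simp: set_matches)
  have "a < length heap" if S: "S \<in> states" "Ptr a \<in> set (node_record S)" for S a
  proof -
    consider "link addr (children S) = (Ptr a :: 'p cell)" | "link addr (after (children (butlast S)) S) = (Ptr a :: 'p cell)"
      | "state_cell addr (fail S) = (Ptr a :: 'p cell)" | "link pattern_addr (matches S) = (Ptr a :: 'p cell)"
      using S(2) by (auto simp: node_record_def dest: sym split: if_splits)
    then show ?thesis
    proof cases
      case 3
      then show ?thesis
        using state_cell_PtrD[OF 3] fail_SomeD(1)[OF S(1)] addr_less[of _ 0] by auto
    next
      case 1
      then show ?thesis using child by (rule link_addr_less)
    next
      case 2
      then show ?thesis using order_trans[OF set_after child] by (rule link_addr_less)
    next
      case 4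
      then show ?thesis using match by (rule link_pattern_addr_less)
    qed
  qed
  moreover have "a < length heap" if "Ptr a \<in> set (pattern_record k)" for k a
  proof -
    have "link pattern_addr (after (matches (f (Ps ! k))) k) = (Ptr a :: 'p cell)"
      using that by (auto simp: pattern_record_def dest: sym)
    then show ?thesis
      using order_trans[OF set_after match] by (rule link_pattern_addr_less)
  qed
  moreover have "Pat k \<notin> set (node_record S)" for S k
    by (auto simp: node_record_def)
  moreover have "k' = k" if "Pat k' \<in> set (pattern_record k)" for k k'
    using that by (simp add: pattern_record_def)
  ultimately show ?thesis
    unfolding wf_heap_def by (fastforce simp: heap_def set_nodes)
qed

text \<open>With total size \<open>m\<close> and \<open>d\<close> patterns there are at most
  \<open>5 * (m + 1) + 2 * d\<close> cells. Nonempty patterns give \<open>d\<close> \<le>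
  \<open>m\<close>, and a nonempty dictionary then gives \<open>1\<close> \<le> \<open>m\<close>,
  which absorbs the additive 5.\<close>

lemma length_heap_le: "length heap \<le> 12 * (\<Sum>P\<leftarrow>Ps. length P)"
proof -
  have "length xs \<le> (\<Sum>P\<leftarrow>xs. length P)" if "[] \<notin> set xs" for xs :: "'a list list"
    using that
  proof (induction xs)
    case (Cons x xs)
    then show ?case by (cases x) auto
  qed simp
  from this[OF patterns_nonempty] have "length Ps \<le> (\<Sum>P\<leftarrow>Ps. length P)" .
  moreover have "1 \<le> length Ps" using dict_nonempty by (cases Ps) auto
  ultimately show ?thesis using length_nodes by (simp add: length_heap)
qed

section \<open>Correctness of the programs\<close>

lemma exec_Load_node:
  assumes "s y = Ptr (addr S)" "S \<in> states" "r < 5"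
  shows "exec heap (Load x y r) s [] (s(x := node_record S ! r))"
  using exec.Load[of s y "addr S" r heap x] assms addr_less heap_node by simp

lemma exec_Load_pattern:
  assumes "s y = Ptr (pattern_addr k)" "k < length Ps" "r < 2"
  shows "exec heap (Load x y r) s [] (s(x := pattern_record k ! r))"
  using exec.Load[of s y "pattern_addr k" r heap x] assms pattern_addr_less heap_pattern by simp

lemma exec_Seq_silent:
  "exec h c1 s [] s1 \<Longrightarrow> exec h c2 s1 w s2 \<Longrightarrow> exec h (Seq c1 c2) s w s2"
  using exec.Seq[of h c1 s "[]" s1 c2 w s2] by simp

text \<open>A child of \<open>S\<close> is determined by its last symbol, so linear search through
  the children computes goto.\<close>

lemma find_children: "find (\<lambda>T. last T = c) (children S) = scera_goto f (set Ps) S c"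
proof (cases "S @ [c] \<in> states")
  case True
  have uniq: "T = S @ [c]" if "T \<in> set (children S)" "last T = c" for T
    using that by (auto simp: set_children)
  have "find (\<lambda>T. last T = c) (children S) \<noteq> None"
    using True by (auto simp: find_None_iff set_children intro!: exI[of _ "S @ [c]"])
  then obtain T where T: "find (\<lambda>T. last T = c) (children S) = Some T" by blast
  then have "T = S @ [c]"
    using uniq by (auto simp: find_Some_iff)
  then show ?thesis using T True by (simp add: scera_goto_def)
next
  case False
  then have "find (\<lambda>T. last T = c) (children S) = None"
    by (auto simp: find_None_iff set_children)
  then show ?thesis using False by (simp add: scera_goto_def)
qed

text \<open>Establishes the loop invariant: register 2 holds the edge symbol of the head of the
  remaining children, or \<open>c\<close> itself when none remain.\<close>

lemma exec_goto_step:
  assumes "set Ts \<subseteq> states - {[]}" "s 0 = link addr Ts" "s 1 = Sym c"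
  shows "exec heap goto_step s [] (s(2 := Sym (case Ts of [] \<Rightarrow> c | T # _ \<Rightarrow> last T)))"
proof (cases Ts)
  case Nil
  then have "exec heap (Move 2 1) s [] (s(2 := Sym c))"
    using exec.Move[of heap 2 1 s] assms(3) by simp
  then show ?thesis
    unfolding goto_step_def using Nil assms(2) by (auto intro: exec.CondT)
next
  case (Cons T Us)
  then have "exec heap (Load 2 0 2) s [] (s(2 := node_record T ! 2))"
    using assms(1,2) by (intro exec_Load_node) auto
  moreover have "node_record T ! 2 = Sym (last T)"
    using Cons assms(1) by (auto simp: node_record_def)
  ultimately show ?thesis
    unfolding goto_step_def using Cons assms(2) by (auto intro: exec.CondF)
qed

text \<open>\<open>Us\<close> are the children already passed. They stay in the statement because
  the sibling pointer of the current child is defined through its place in the full list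
  \<open>children S\<close>.\<close>

lemma exec_goto_loop:
  assumes "children S = Us @ Ts" "s 0 = link addr Ts" "s 1 = Sym c"
    "s 2 = Sym (case Ts of [] \<Rightarrow> c | T # _ \<Rightarrow> last T)"
  shows "\<exists>s'. exec heap goto_loop s [] s' \<and> s' 0 = state_cell addr (find (\<lambda>T. last T = c) Ts)"
  using assms
proof (induction Ts arbitrary: Us s)
  case Nil
  then have "exec heap goto_loop s [] s"
    unfolding goto_loop_def by (intro exec.LoopF) simp
  then show ?case using Nil by auto
next
  case (Cons T Ts)
  show ?case
  proof (cases "last T = c")
    case True
    then have "exec heap goto_loop s [] s"
      unfolding goto_loop_def using Cons.prems by (intro exec.LoopF) simp
    then show ?thesis using Cons.prems True by auto
  next
    case False
    have sub: "set (T # Ts) \<subseteq> states - {[]}" and T: "butlast T = S"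
      using Cons.prems(1) set_children[of S] by auto
    have sibling: "node_record T ! 1 = link addr Ts"
      using after_append[of Us T Ts] distinct_children[of S] Cons.prems(1) T
      by (simp add: node_record_def)
    let ?s1 = "s(0 := link addr Ts)"
    let ?s2 = "?s1(2 := Sym (case Ts of [] \<Rightarrow> c | T # _ \<Rightarrow> last T))"
    have "exec heap (Load 0 0 1) s [] ?s1"
      using exec_Load_node[of s 0 T 1 0] Cons.prems(2) sub sibling by simp
    moreover have "exec heap goto_step ?s1 [] ?s2"
      using Cons.prems(3) sub by (intro exec_goto_step) auto
    ultimately have body: "exec heap (Seq (Load 0 0 1) goto_step) s [] ?s2"
      by (rule exec_Seq_silent)
    have "\<exists>s'. exec heap goto_loop ?s2 [] s' \<and>
        s' 0 = state_cell addr (find (\<lambda>T. last T = c) Ts)"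
      by (rule Cons.IH[of "Us @ [T]"]) (use Cons.prems(1,3) in simp_all)
    then obtain s' where s': "exec heap goto_loop ?s2 [] s'"
      "s' 0 = state_cell addr (find (\<lambda>T. last T = c) Ts)"
      by blast
    have "exec heap goto_loop s ([] @ []) s'"
      unfolding goto_loop_def
      by (rule exec.LoopT[OF _ body s'(1)[unfolded goto_loop_def]])
        (use Cons.prems False in simp)
    then show ?thesis using s'(2) False by auto
  qed
qed

lemma exec_goto_program:
  assumes "S \<in> states"
  shows "\<exists>s. exec heap goto_program (init_regs [Ptr (addr S), Sym c]) [] s \<and>
           s 0 = state_cell addr (scera_goto f (set Ps) S c)"
proof -
  let ?s0 = "init_regs [Ptr (addr S), Sym c]"
  let ?s1 = "?s0(0 := link addr (children S))"
  let ?s2 = "?s1(2 := Sym (case children S of [] \<Rightarrow> c | T # _ \<Rightarrow> last T))"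
  have "exec heap (Load 0 0 0) ?s0 [] ?s1"
    using exec_Load_node[of ?s0 0 S 0 0] assms by (simp add: init_regs_def node_record_def)
  moreover have "exec heap goto_step ?s1 [] ?s2"
    by (intro exec_goto_step) (auto simp: set_children init_regs_def)
  moreover obtain s where "exec heap goto_loop ?s2 [] s"
    "s 0 = state_cell addr (find (\<lambda>T. last T = c) (children S))"
    using exec_goto_loop[of S "[]" "children S" ?s2 c] by (auto simp: init_regs_def)
  ultimately show ?thesis
    unfolding goto_program_def find_children by (meson exec_Seq_silent)
qed

lemma exec_fail_program:
  assumes "S \<in> states"
  shows "\<exists>s. exec heap fail_program (init_regs [Ptr (addr S)]) [] s \<and>
           s 0 = state_cell addr (fail S)"
proof -
  let ?s0 = "init_regs [Ptr (addr S)]"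
  have "exec heap fail_program ?s0 [] (?s0(0 := node_record S ! 3))"
    unfolding fail_program_def using assms by (intro exec_Load_node) (auto simp: init_regs_def)
  then show ?thesis by (force simp: node_record_def)
qed

text \<open>As in the goto loop, \<open>js\<close> is the part already traversed, needed to identify
  the stored next pointer with the rest \<open>ks\<close>.\<close>

lemma exec_pattern_loop:
  assumes "matches S = js @ ks" "s 1 = link pattern_addr ks"
  shows "\<exists>s'. exec heap pattern_loop s (map Pat ks) s' \<and> s' 0 = s 0"
  using assms
proof (induction ks arbitrary: js s)
  case Nil
  then have "exec heap pattern_loop s [] s"
    unfolding pattern_loop_def by (intro exec.LoopF) simp
  then show ?case by auto
next
  case (Cons k ks)
  have k: "k < length Ps" "f (Ps ! k) = S"
    using Cons.prems(1) set_matches[of S] by auto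
  have rec: "pattern_record k ! 0 = Pat k" "pattern_record k ! 1 = link pattern_addr ks"
    using after_append[of js k ks] distinct_matches[of S] Cons.prems(1) k(2)
    by (simp_all add: pattern_record_def)
  let ?s1 = "s(2 := Pat k)"
  let ?s2 = "?s1(1 := link pattern_addr ks)"
  have "exec heap (Load 2 1 0) s [] ?s1"
    using exec_Load_pattern[of s 1 k 0 2] Cons.prems(2) k(1) rec by simp
  moreover have "exec heap (Emit 2) ?s1 [Pat k] ?s1"
    using exec.Emit[of heap 2 ?s1] by simp
  moreover have "exec heap (Load 1 1 1) ?s1 [] ?s2"
    using exec_Load_pattern[of ?s1 1 k 1 1] Cons.prems(2) k(1) rec by simp
  ultimately have body: "exec heap (Seq (Load 2 1 0) (Seq (Emit 2) (Load 1 1 1))) s [Pat k] ?s2"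
    using exec_Seq_silent exec.Seq[of heap "Emit 2" ?s1 "[Pat k]" ?s1 "Load 1 1 1" "[]" ?s2]
    by simp
  have "\<exists>s'. exec heap pattern_loop ?s2 (map Pat ks) s' \<and> s' 0 = ?s2 0"
    by (rule Cons.IH[of "js @ [k]"]) (use Cons.prems(1) in simp_all)
  then obtain s' where s': "exec heap pattern_loop ?s2 (map Pat ks) s'" "s' 0 = s 0"
    by auto
  have "exec heap pattern_loop s ([Pat k] @ map Pat ks) s'"
    unfolding pattern_loop_def
    by (rule exec.LoopT[OF _ body s'(1)[unfolded pattern_loop_def]])
      (use Cons.prems in simp)
  then show ?case using s'(2) by auto
qed

lemma exec_out_program_Null: "s 0 = Null \<Longrightarrow> exec heap out_program s [] s"
  unfolding out_program_def by (intro exec.LoopF) simp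

text \<open>
  The bound on the lengths makes the induction go through: failure links shorten the state, so
  no pattern is emitted at two states of the chain.
\<close>

lemma exec_out_program:
  assumes "S \<in> states" "s 0 = Ptr (addr S)"
  shows "\<exists>ks s'. exec heap out_program s (map Pat ks) s' \<and> distinct ks \<and>
           set ks = {k. k < length Ps \<and> Ps ! k \<in> out S} \<and>
           (\<forall>k\<in>set ks. length (Ps ! k) \<le> length S)"
  using assms
proof (induction "length S" arbitrary: S s rule: less_induct)
  case less
  let ?s1 = "s(1 := link pattern_addr (matches S))"
  have load1: "exec heap (Load 1 0 4) s [] ?s1"
    using exec_Load_node[of s 0 S 4 1] less.prems by (simp add: node_record_def)
  obtain s2 where s2: "exec heap pattern_loop ?s1 (map Pat (matches S)) s2" "s2 0 = s 0"
    using exec_pattern_loop[of S "[]" "matches S" ?s1] by auto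
  let ?s3 = "s2(0 := state_cell addr (fail S))"
  have load2: "exec heap (Load 0 0 3) s2 [] ?s3"
    using exec_Load_node[of s2 0 S 3 0] less.prems s2(2) by (simp add: node_record_def)
  have body: "exec heap (Seq (Load 1 0 4) (Seq pattern_loop (Load 0 0 3))) s
      (map Pat (matches S)) ?s3"
    using exec_Seq_silent[OF load1 exec.Seq[OF s2(1) load2]] by simp
  \<comment> \<open>One round of the outer loop puts the patterns of the current node in front of
    whatever the rest of the chain emits.\<close>
  have run: "exec heap out_program s (map Pat (matches S @ ks)) s'"
    if "exec heap out_program ?s3 (map Pat ks) s'" for ks s'
    unfolding out_program_def map_append
    by (rule exec.LoopT[OF _ body that[unfolded out_program_def]]) (use less.prems in simp)
  have len: "length (Ps ! k) = length S" if "k \<in> set (matches S)" for k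
    using that length_f[of "Ps ! k"] by (simp add: set_matches del: length_f)
  show ?case
  proof (cases "fail S")
    case None
    then have S: "S = []" using fail_eq_NoneD less.prems(1) by blast
    \<comment> \<open>The chain ends at the root, where nothing may be emitted: no pattern is empty,
      so none has the empty code.\<close>
    have "matches S = []"
      using patterns_nonempty nth_mem[of _ Ps] set_matches[of S] S
      by (metis (mono_tags, lifting) f_eq_Nil_iff last_in_set mem_Collect_eq)
    then show ?thesis
      using run[of "[]" ?s3] exec_out_program_Null[of ?s3] None S
      by (intro exI[of _ "[]"] exI[of _ ?s3]) (simp add: out_Nil)
  next
    case (Some T)
    have T: "T \<in> states" "length T < length S"
      using fail_SomeD[OF less.prems(1) Some] by auto
    obtain ks s' where ks: "exec heap out_program ?s3 (map Pat ks) s'" "distinct ks"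
      "set ks = {k. k < length Ps \<and> Ps ! k \<in> out T}" "\<forall>k\<in>set ks. length (Ps ! k) \<le> length T"
      using less.hyps[OF T(2,1), of ?s3] Some by auto
    have "set (matches S) \<inter> set ks = {}"
      using len ks(4) T(2) by fastforce
    then have "distinct (matches S @ ks)"
      using distinct_matches ks(2) by simp
    moreover have "set (matches S @ ks) = {k. k < length Ps \<and> Ps ! k \<in> out S}"
      using out_rec[OF less.prems(1) Some] ks(3) by (auto simp: set_matches)
    moreover have "\<forall>k\<in>set (matches S @ ks). length (Ps ! k) \<le> length S"
      using len ks(4) T(2) by fastforce
    ultimately show ?thesis using run[OF ks(1)] by blast
  qed
qed

lemma implements_scera_heap:
  "implements_scera eqv f Ps goto_program fail_program out_program heap"
  unfolding implements_scera_def
proof (intro conjI exI[of _ addr] ballI allI)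
  fix S assume S: "S \<in> states"
  show "addr S < length heap"
    using addr_less[OF S, of 0] by simp
  show "\<exists>ks s. exec heap out_program (init_regs [Ptr (addr S)]) (map Pat ks) s \<and> distinct ks \<and>
      set ks = {k. k < length Ps \<and> Ps ! k \<in> out S}"
    using exec_out_program[OF S, of "init_regs [Ptr (addr S)]"] by (auto simp: init_regs_def)
qed (use wf_heap_heap inj_on_addr addr_Nil exec_goto_program exec_fail_program in blast)+

end

text \<open>There are no states, so all conditions on queries hold vacuously, and the empty heap
  meets a space bound of 0.\<close>

lemma implements_scera_empty: "implements_scera eqv f [] gp fp op []"
  unfolding implements_scera_def
  by (auto simp: wf_heap_def scera_states_def intro!: exI[of _ "\<lambda>_. 0"])

theorem theorem1:
  fixes eqv :: "'a list \<Rightarrow> 'a list \<Rightarrow> bool"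
    and f :: "'a list \<Rightarrow> 'p list"
    and sz :: "'p \<Rightarrow> nat" and K :: nat
  assumes "SCER eqv"
    and "prefix_encoding eqv f"
    and "\<forall>x. sz x \<le> K"
  shows "\<exists>goto_prog fail_prog out_prog. \<exists>C::nat.
           \<forall>Ps. distinct Ps \<and> [] \<notin> set Ps \<longrightarrow>
             (\<exists>h. implements_scera eqv f Ps goto_prog fail_prog out_prog h \<and>
                  heap_space sz h \<le> C * (\<Sum>P\<leftarrow>Ps. length P))"
\<comment> \<open>Programs and constant are fixed before the dictionary; only the heap depends on
  it. The constant is the cost per cell times the 12 cells per symbol of the dictionary.\<close>
proof (rule exI[of _ goto_program], rule exI[of _ fail_program], rule exI[of _ out_program],
    rule exI[of _ "max 1 K * 12"], intro allI impI)
  fix Ps :: "'a list list"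
  assume Ps: "distinct Ps \<and> [] \<notin> set Ps"
  show "\<exists>h. implements_scera eqv f Ps goto_program fail_program out_program h \<and>
      heap_space sz h \<le> max 1 K * 12 * (\<Sum>P\<leftarrow>Ps. length P)"
  proof (cases "Ps = []")
    case True
    then show ?thesis
      using implements_scera_empty by (intro exI[of _ "[]"]) (simp add: heap_space_def)
  next
    case False
    then interpret scera_dictionary eqv f Ps
      using assms(1,2) Ps by unfold_locales auto
    have "heap_space sz heap \<le> max 1 K * length heap"
      by (rule heap_space_le[OF assms(3)])
    also have "\<dots> \<le> max 1 K * (12 * (\<Sum>P\<leftarrow>Ps. length P))"
      by (rule mult_le_mono2[OF length_heap_le])
    finally show ?thesis
      using implements_scera_heap by (auto simp: mult.assoc)
  qed
qed

end
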